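(* The equation $$\gamma-\sqrt\gamma\sqrt{1+\gamma}=\frac{-\gamma}{1+\gamma}$$ has a unique solution $\gamma>0$, namely $\gamma_m^*=(\sqrt5-1)/2\approx0.618$. If $\gamma>\gamma_m^*$, then the single-spike optimal nonlinearity $\eta_1^*(\cdot;\gamma)$ is also optimal when applied in the multi-spike case $r>1$: for every $r>1$, every spike configuration $\ell_1>\ell_2>\dots>\ell_r>1$ and every $p>2r$, $$\kappa\big(\Delta^a((\ell_i);(\eta_1^*(\lambda(\ell_i;\gamma);\gamma))_{i=1}^r)\big)=\min_{(\eta_i)_{i=1}^r\in(0,\infty)^r}\kappa\big(\Delta^a((\ell_i);(\eta_i)_{i=1}^r)\big).$$
   Context: $\kappa$ denotes condition number. For $\gamma>0$: $\ell_+(\gamma)=1+\sqrt\gamma$, $\lambda_+(\gamma)=(1+\sqrt\gamma)^2$; $\lambda(\ell;\gamma)=\ell(1+\frac{\gamma}{\ell-1})$ for $\ell>\ell_+(\gamma)$ and $\lambda_+(\gamma)$ for $\ell\le\ell_+(\gamma)$; for $\lambda>\lambda_+(\gamma)$ the inverse is $\ell(\lambda;\gamma)=\frac{\lambda+1-\gamma+\sqrt{(\lambda+1-\gamma)^2-4\lambda}}{2}$. $c(\ell;\gamma)=\sqrt{\frac{1-\gamma/(\ell-1)^2}{1+\gamma/(\ell-1)}}$ for $\ell>\ell_+(\gamma)$, $c=0$ for $\ell\le\ell_+(\gamma)$; $s=\sqrt{1-c^2}$. $$A(\ell,\eta;\gamma)=\begin{bmatrix}\frac{\eta c^2+s^2}{\ell}&\frac{(\eta-1)cs}{\sqrt\ell}\\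 \frac{(\eta-1)cs}{\sqrt\ell}&c^2+\eta s^2\end{bmatrix}.$$ The asymptotic pivot is the $p\times p$ matrix $\Delta^a((\ell_i);(\eta_i)_{i=1}^r)=\bigoplus_{i=1}^rA(\ell_i,\eta_i;\gamma)\oplus I_{p-2r}$ ($p>2r$). Single-spike optimal nonlinearity: with $\ell_1^+(\gamma)=1+(\gamma+\sqrt{\gamma^2+8\gamma})/2$, $\eta_1^*(\lambda;\gamma)=\frac{\ell}{1+\gamma+2\gamma/(\ell-1)}$ with $\ell=\ell(\lambda;\gamma)$ if $\lambda>\lambda_+(\gamma)$ and $\ell(\lambda;\gamma)>\ell_1^+(\gamma)$, and $\eta_1^*(\lambda;\gamma)=1$ otherwise. *)

theory Defs
  imports Complex_Main "Jordan_Normal_Form.Char_Poly"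
begin

text \<open>
  The spectral condition number, as the ratio of the extreme singular values. It is meaningful
  only for a nonsingular square matrix with at least one row (for a singular one the true value
  is infinite, whereas the quotient below is 0). The pivots considered here are
  nonsingular: the block \<open>A(l, \<eta>; \<gamma>)\<close> has determinant \<open>\<eta> / l\<close>.
\<close>

definition singular_values :: "real mat \<Rightarrow> real set" where
  "singular_values M = {sqrt e | e. eigenvalue (transpose_mat M * M) e}"

definition condition_number :: "real mat \<Rightarrow> real" where
  "condition_number M = Max (singular_values M) / Min (singular_values M)"

definition ell_plus :: "real \<Rightarrow> real" where
  "ell_plus \<gamma> = 1 + sqrt \<gamma>"

definition lambda_plus :: "real \<Rightarrow> real" where
  "lambda_plus \<gamma> = (1 + sqrt \<gamma>)\<^sup>2"

definition lambda_of :: "real \<Rightarrow> real \<Rightarrow> real" where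
  "lambda_of l \<gamma> = (if l > ell_plus \<gamma> then l * (1 + \<gamma> / (l - 1)) else lambda_plus \<gamma>)"

text \<open>Inverse of the function above; intended for \<open>lam > lambda_plus \<gamma>\<close> only.\<close>

definition ell_of :: "real \<Rightarrow> real \<Rightarrow> real" where
  "ell_of lam \<gamma> = (lam + 1 - \<gamma> + sqrt ((lam + 1 - \<gamma>)\<^sup>2 - 4 * lam)) / 2"

definition cosine :: "real \<Rightarrow> real \<Rightarrow> real" where
  "cosine l \<gamma> =
    (if l > ell_plus \<gamma> then sqrt ((1 - \<gamma> / (l - 1)\<^sup>2) / (1 + \<gamma> / (l - 1))) else 0)"

definition sine :: "real \<Rightarrow> real \<Rightarrow> real" where
  "sine l \<gamma> = sqrt (1 - (cosine l \<gamma>)\<^sup>2)"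

definition pivot_block :: "real \<Rightarrow> real \<Rightarrow> real \<Rightarrow> real mat" where
  "pivot_block l \<eta> \<gamma> = (let c = cosine l \<gamma>; s = sine l \<gamma> in
    mat_of_rows_list 2
      [[(\<eta> * c\<^sup>2 + s\<^sup>2) / l, (\<eta> - 1) * c * s / sqrt l],
       [(\<eta> - 1) * c * s / sqrt l, c\<^sup>2 + \<eta> * s\<^sup>2]])"

text \<open>
  Only the values \<open>l i\<close> and \<open>\<eta> i\<close> with \<open>1 \<le> i \<le> r\<close> enter. The matrix is
  \<open>p \<times> p\<close> when \<open>p \<ge> 2 * r\<close>; for smaller \<open>p\<close> the subtraction truncates.
\<close>

definition asymptotic_pivot ::
    "nat \<Rightarrow> nat \<Rightarrow> real \<Rightarrow> (nat \<Rightarrow> real) \<Rightarrow> (nat \<Rightarrow> real) \<Rightarrow> real mat" where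
  "asymptotic_pivot p r \<gamma> l \<eta> =
    diag_block_mat (map (\<lambda>i. pivot_block (l i) (\<eta> i) \<gamma>) [1..<r + 1] @ [1\<^sub>m (p - 2 * r)])"

definition ell1_plus :: "real \<Rightarrow> real" where
  "ell1_plus \<gamma> = 1 + (\<gamma> + sqrt (\<gamma>\<^sup>2 + 8 * \<gamma>)) / 2"

definition eta1_star :: "real \<Rightarrow> real \<Rightarrow> real" where
  "eta1_star lam \<gamma> =
    (if lam > lambda_plus \<gamma> \<and> ell_of lam \<gamma> > ell1_plus \<gamma>
     then let l = ell_of lam \<gamma> in l / (1 + \<gamma> + 2 * \<gamma> / (l - 1))
     else 1)"

end

theory Submission
  imports Defs
begin

text \<open>
  The singular values of the pivot are 1 and, for each spike, the two roots \<open>u \<le> w\<close> of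
  \<open>t\<^sup>2 - (a + b \<eta>) t + \<eta> / l\<close>, where \<open>a + b \<eta>\<close> is the trace of the block. Since
  \<open>w / u\<close> increases with \<open>(u + w)\<^sup>2 / (u w)\<close>, the block of the largest spike alone bounds the
  condition number from below by AM-GM, with equality at \<open>\<eta> = a / b\<close>, the single-spike optimum
  if \<open>a > b\<close>; if \<open>a \<le> b\<close>, the singular value 1 makes \<open>\<eta> = 1\<close> optimal.
  The bound is attained as soon as the root intervals \<open>[u, w]\<close> of the optimally shrunk blocks are
  nested, increasing with the spike. With \<open>y = 1 + \<gamma> / (l - 1)\<close> the polynomial becomes
  \<open>t\<^sup>2 - 2 t / y + 1 / (2 y + \<gamma> - 1)\<close>, and nestedness reduces to
  \<open>y\<^sup>4 + (\<gamma> - 1) (2 y + \<gamma> - 1)\<^sup>2 > 0\<close> for \<open>y \<ge> 1\<close>. At \<open>y = 1\<close> this is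
  \<open>1 + (\<gamma> - 1) (\<gamma> + 1)\<^sup>2 > 0\<close>, that is, \<open>\<gamma>\<^sup>2 + \<gamma> > 1\<close>: the golden ratio threshold.
\<close>

section \<open>Singular values of block-diagonal matrices\<close>

text \<open>Subtracting \<open>e\<close> on the diagonal keeps the block shape, so the
  characteristic determinant is a product.\<close>

lemma eigenvalue_diag_four_block_mat:
  fixes A B :: "'a :: field mat"
  assumes A: "A \<in> carrier_mat n n" and B: "B \<in> carrier_mat m m"
  shows "eigenvalue (four_block_mat A (0\<^sub>m n m) (0\<^sub>m m n) B) e \<longleftrightarrow> eigenvalue A e \<or> eigenvalue B e"
proof -
  let ?M = "four_block_mat A (0\<^sub>m n m) (0\<^sub>m m n) B"
  have M: "?M \<in> carrier_mat (n + m) (n + m)"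
    using A B by simp
  have "char_matrix ?M e = four_block_mat (char_matrix A e) (0\<^sub>m n m) (0\<^sub>m m n) (char_matrix B e)"
    by (rule eq_matI, insert A B, auto simp: char_matrix_def)
  also have "det \<dots> = det (char_matrix A e) * det (char_matrix B e)"
    by (rule det_four_block_mat_lower_left_zero, insert A B, auto)
  finally show ?thesis
    by (simp add: eigenvalue_det[OF M] eigenvalue_det[OF A] eigenvalue_det[OF B])
qed

lemma singular_values_diag_four_block_mat:
  assumes A: "A \<in> carrier_mat n n" and B: "B \<in> carrier_mat m m"
  shows "singular_values (four_block_mat A (0\<^sub>m n m) (0\<^sub>m m n) B) = singular_values A \<union> singular_values B"
proof -
  let ?M = "four_block_mat A (0\<^sub>m n m) (0\<^sub>m m n) B"
  have "transpose_mat ?M = four_block_mat (transpose_mat A) (0\<^sub>m n m) (0\<^sub>m m n) (transpose_mat B)"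
    using A B by (subst transpose_four_block_mat) auto
  then have "transpose_mat ?M * ?M =
      four_block_mat (transpose_mat A * A) (0\<^sub>m n m) (0\<^sub>m m n) (transpose_mat B * B)"
    using A B by (simp, subst mult_four_block_mat[of _ n n _ m _ m]) auto
  moreover have "transpose_mat A * A \<in> carrier_mat n n" "transpose_mat B * B \<in> carrier_mat m m"
    using A B by auto
  ultimately show ?thesis
    by (auto simp: singular_values_def eigenvalue_diag_four_block_mat)
qed

lemma singular_values_diag_block_mat:
  assumes "\<forall>A\<in>set As. square_mat A"
  shows "singular_values (diag_block_mat As) = (\<Union>A\<in>set As. singular_values A)"
  using assms
proof (induction As)
  case Nil
  \<comment> \<open>The empty list gives the matrix of size 0, which has no nonzero vector and hence
    no eigenvalue.\<close>
  show ?case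
    by (auto simp: singular_values_def eigenvalue_def eigenvector_def)
next
  case (Cons A As)
  let ?B = "diag_block_mat As"
  obtain n where A: "A \<in> carrier_mat n n"
    using Cons.prems by auto
  obtain m where B: "?B \<in> carrier_mat m m"
    using Cons.prems diag_block_mat_square[of As] by auto
  have "diag_block_mat (A # As) = four_block_mat A (0\<^sub>m n m) (0\<^sub>m m n) ?B"
    using A B by (simp add: Let_def)
  then show ?case
    using Cons by (simp add: singular_values_diag_four_block_mat[OF A B])
qed

lemma singular_values_one:
  assumes "n > 0"
  shows "singular_values (1\<^sub>m n) = {1}"
proof -
  have "eigenvalue (1\<^sub>m n :: real mat) e \<longleftrightarrow> e = 1" for e
  proof -
    have "char_matrix (1\<^sub>m n :: real mat) e = (1 - e) \<cdot>\<^sub>m 1\<^sub>m n"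
      by (rule eq_matI) (auto simp: char_matrix_def)
    then show ?thesis
      using assms by (simp add: eigenvalue_det[of _ n])
  qed
  then show ?thesis
    by (auto simp: singular_values_def)
qed

section \<open>Two-by-two matrices\<close>

lemma det_carrier_2:
  fixes A :: "'a :: comm_ring_1 mat"
  assumes "A \<in> carrier_mat 2 2"
  shows "det A = A $$ (0, 0) * A $$ (1, 1) - A $$ (1, 0) * A $$ (0, 1)"
proof -
  have "det A = (\<Sum>i<2. A $$ (i, 0) * cofactor A i 0)"
    using assms by (rule laplace_expansion_column) simp
  also have "\<dots> = A $$ (0, 0) * A $$ (1, 1) - A $$ (1, 0) * A $$ (0, 1)"
    using assms by (simp add: numeral_2_eq_2 cofactor_def mat_delete_def det_single)
  finally show ?thesis .
qed

lemma eigenvalue_mat_of_rows_list_2: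
  fixes a b c d :: real
  shows "eigenvalue (mat_of_rows_list 2 [[a, b], [c, d]]) e \<longleftrightarrow> e\<^sup>2 - (a + d) * e + (a * d - b * c) = 0"
proof -
  let ?M = "mat_of_rows_list 2 [[a, b], [c, d]]"
  have M: "?M \<in> carrier_mat 2 2"
    by (simp add: mat_of_rows_list_def numeral_2_eq_2)
  have "det (char_matrix ?M e) = (a - e) * (d - e) - c * b"
    using det_carrier_2[OF char_matrix_closed[OF M, of e]]
    by (simp add: char_matrix_def mat_of_rows_list_def)
  also have "\<dots> = e\<^sup>2 - (a + d) * e + (a * d - b * c)"
    by (simp add: algebra_simps power2_eq_square)
  finally have "det (char_matrix ?M e) = e\<^sup>2 - (a + d) * e + (a * d - b * c)" .
  then show ?thesis
    by (simp add: eigenvalue_det[OF M])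
qed

text \<open>Positive trace and determinant make the symmetric matrix positive definite, so singular
  values and eigenvalues coincide.\<close>

lemma singular_values_symmetric_2:
  fixes p q t :: real
  assumes T: "p + q > 0" and D: "p * q - t\<^sup>2 > 0"
  shows "singular_values (mat_of_rows_list 2 [[p, t], [t, q]]) =
    {x. x\<^sup>2 - (p + q) * x + (p * q - t\<^sup>2) = 0}"
proof -
  let ?M = "mat_of_rows_list 2 [[p, t], [t, q]]"
  define T where "T = p + q"
  define D where "D = p * q - t\<^sup>2"
  have pos: "T > 0" "D > 0"
    using assms by (simp_all add: T_def D_def)
  have "transpose_mat ?M * ?M =
      mat_of_rows_list 2 [[p\<^sup>2 + t\<^sup>2, p * t + t * q], [p * t + t * q, t\<^sup>2 + q\<^sup>2]]"
    by (rule eq_matI) (auto simp: mat_of_rows_list_def numeral_2_eq_2 less_Suc_eq scalar_prod_def power2_eq_square)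
  \<comment> \<open>The squared matrix has trace \<open>T\<^sup>2 - 2 * D\<close> and determinant
    \<open>D\<^sup>2\<close>. Its characteristic equation is grouped so that
    \<open>e = x\<^sup>2\<close> turns both sides into squares.\<close>
  then have ev: "eigenvalue (transpose_mat ?M * ?M) e \<longleftrightarrow> (e + D)\<^sup>2 = T\<^sup>2 * e" for e
    by (simp add: eigenvalue_mat_of_rows_list_2 T_def D_def) (auto simp: algebra_simps power2_eq_square)
  have "x \<in> singular_values ?M \<longleftrightarrow> x\<^sup>2 - T * x + D = 0" for x
  proof
    assume "x \<in> singular_values ?M"
    then obtain e where e: "x = sqrt e" "(e + D)\<^sup>2 = T\<^sup>2 * e"
      by (auto simp: singular_values_def ev)
    have "T\<^sup>2 * e \<ge> 0"
      by (simp flip: e(2))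
    then have "e \<ge> 0"
      using pos by (simp add: zero_le_mult_iff)
    then have x: "x \<ge> 0" "e = x\<^sup>2"
      by (simp_all add: e)
    have "(x\<^sup>2 + D)\<^sup>2 = (T * x)\<^sup>2"
      using e(2) unfolding x(2) by (simp only: power_mult_distrib)
    then have "x\<^sup>2 + D = T * x"
      using pos x by (subst (asm) power2_eq_iff_nonneg) auto
    then show "x\<^sup>2 - T * x + D = 0"
      by simp
  next
    assume *: "x\<^sup>2 - T * x + D = 0"
    then have "x\<^sup>2 + D = T * x"
      by simp
    moreover from this have "T * x > 0"
      using pos by (metis add_nonneg_pos zero_le_power2)
    then have "x > 0"
      using pos by (simp add: zero_less_mult_iff)
    ultimately show "x \<in> singular_values ?M"
      by (auto simp: singular_values_def ev power_mult_distrib intro!: exI[of _ "x\<^sup>2"])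
  qed
  then show ?thesis
    by (auto simp: T_def D_def)
qed

section \<open>Nestedness of the root intervals\<close>

lemma golden_equation:
  "{\<gamma>::real. \<gamma> > 0 \<and> \<gamma> - sqrt \<gamma> * sqrt (1 + \<gamma>) = - \<gamma> / (1 + \<gamma>)} = {(sqrt 5 - 1) / 2}"
proof -
  have "\<gamma> - sqrt \<gamma> * sqrt (1 + \<gamma>) = - \<gamma> / (1 + \<gamma>) \<longleftrightarrow> \<gamma> = (sqrt 5 - 1) / 2"
    if "\<gamma> > 0" for \<gamma> :: real
  proof -
    have "\<gamma> - sqrt \<gamma> * sqrt (1 + \<gamma>) = - \<gamma> / (1 + \<gamma>) \<longleftrightarrow> sqrt (\<gamma> * (1 + \<gamma>)) = \<gamma> + \<gamma> / (1 + \<gamma>)"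
      by (auto simp: real_sqrt_mult)
    \<comment> \<open>Both sides are positive, so squaring is an equivalence.\<close>
    also have "\<dots> \<longleftrightarrow> \<gamma> * (1 + \<gamma>) = (\<gamma> + \<gamma> / (1 + \<gamma>))\<^sup>2"
      using that by (subst real_sqrt_eq_iff[symmetric]) (simp add: real_sqrt_abs)
    also have "\<dots> \<longleftrightarrow> (1 + \<gamma>) ^ 3 = \<gamma> * (2 + \<gamma>)\<^sup>2"
    proof -
      have "\<gamma> + \<gamma> / (1 + \<gamma>) = \<gamma> * (2 + \<gamma>) / (1 + \<gamma>)"
        using that by (simp add: field_simps)
      moreover have "(\<gamma> * (2 + \<gamma>) / (1 + \<gamma>))\<^sup>2 = \<gamma> * (\<gamma> * (2 + \<gamma>)\<^sup>2) / (1 + \<gamma>)\<^sup>2"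
        by (simp add: power_mult_distrib power_divide power2_eq_square)
      moreover have "\<gamma> * (1 + \<gamma>) = \<gamma> * (\<gamma> * (2 + \<gamma>)\<^sup>2) / (1 + \<gamma>)\<^sup>2 \<longleftrightarrow>
          \<gamma> * (1 + \<gamma>) ^ 3 = \<gamma> * (\<gamma> * (2 + \<gamma>)\<^sup>2)"
        using that by (simp add: eq_divide_eq power2_eq_square power3_eq_cube mult.assoc)
      ultimately show ?thesis
        using that by simp
    qed
    \<comment> \<open>The cubes cancel; what remains is
      \<open>\<gamma>\<^sup>2 + \<gamma> = 1\<close> with the square completed.\<close>
    also have "\<dots> \<longleftrightarrow> (2 * \<gamma> + 1)\<^sup>2 = (sqrt 5)\<^sup>2"
      by (auto simp: power2_eq_square power3_eq_cube algebra_simps)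
    also have "\<dots> \<longleftrightarrow> 2 * \<gamma> + 1 = sqrt 5"
      using that by (subst power2_eq_iff_nonneg) auto
    finally show ?thesis
      by (auto simp: field_simps)
  qed
  moreover have "(sqrt 5 - 1) / 2 > (0::real)"
    by simp
  ultimately show ?thesis
    by blast
qed

lemma above_golden_ratio:
  fixes \<gamma> :: real
  assumes "\<gamma> > (sqrt 5 - 1) / 2"
  shows "\<gamma> > 0" "\<gamma>\<^sup>2 + \<gamma> > 1"
proof -
  have "(sqrt 5 - 1) / 2 > (0::real)"
    by simp
  then show "\<gamma> > 0"
    using assms by linarith
  have "(2 * \<gamma> + 1)\<^sup>2 > (sqrt 5)\<^sup>2"
    using assms by (intro power_strict_mono) auto
  then show "\<gamma>\<^sup>2 + \<gamma> > 1"
    by (simp add: power2_eq_square algebra_simps)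
qed

text \<open>With \<open>n = sqrt (1 - \<gamma>)\<close> the quartic is the square of
  \<open>y\<^sup>2\<close> minus the square of \<open>n * (2 * y - n\<^sup>2)\<close>, so it
  suffices to compare these two. The threshold enters as \<open>n\<^sup>2 + n < 1\<close>.\<close>

lemma quartic_pos:
  fixes \<gamma> y :: real
  assumes "\<gamma> > 0" "\<gamma>\<^sup>2 + \<gamma> > 1" "\<gamma> < 1" "y \<ge> 1"
  shows "y ^ 4 + (\<gamma> - 1) * (2 * y + \<gamma> - 1)\<^sup>2 > 0"
proof -
  define n where "n = sqrt (1 - \<gamma>)"
  have n: "n > 0" "n < 1" "\<gamma> = 1 - n\<^sup>2"
    using assms by (auto simp: n_def)
  have "(1 - n\<^sup>2)\<^sup>2 > n\<^sup>2"
    using assms(2) unfolding n(3) by (simp add: power2_eq_square algebra_simps)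
  then have *: "1 - n\<^sup>2 > n"
    using n assms(1) by (metis less_eq_real_def power_less_imp_less_base)
  \<comment> \<open>Expansion around \<open>y = 1\<close>: the second product is the value
    there.\<close>
  have "y\<^sup>2 - 2 * n * y + n ^ 3 = (y - 1) * (y + 1 - 2 * n) + (1 - n) * (1 - n\<^sup>2 - n)"
    by (simp add: power2_eq_square power3_eq_cube algebra_simps)
  moreover have "(y - 1) * (y + 1 - 2 * n) \<ge> 0" "(1 - n) * (1 - n\<^sup>2 - n) > 0"
    using assms n * by auto
  ultimately have "y\<^sup>2 > n * (2 * y - n\<^sup>2)"
    by (simp add: power2_eq_square power3_eq_cube algebra_simps)
  moreover have "n * (2 * y - n\<^sup>2) \<ge> 0"
    using n assms by (intro mult_nonneg_nonneg) auto
  ultimately have "(y\<^sup>2)\<^sup>2 > (n * (2 * y - n\<^sup>2))\<^sup>2"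
    by (intro power_strict_mono) auto
  then show ?thesis
    unfolding n(3) by (simp add: power_mult_distrib flip: power_mult)
qed

section \<open>Comparing the quadratics of two spikes\<close>

lemma quadratic_factor:
  fixes b c s t :: real
  assumes "t\<^sup>2 - b * t + c = 0"
  shows "s\<^sup>2 - b * s + c = (s - t) * (s - (b - t))"
proof -
  have "s\<^sup>2 - b * s + c = s\<^sup>2 - b * s + c - (t\<^sup>2 - b * t + c)"
    using assms by simp
  also have "\<dots> = (s - t) * (s - (b - t))"
    by (simp add: algebra_simps power2_eq_square)
  finally show ?thesis .
qed

text \<open>For \<open>l > ell_plus \<gamma>\<close> and \<open>y = 1 + \<gamma> / (l - 1)\<close>
  this is the characteristic polynomial of the optimally shrunk block: the trace
  \<open>2 / y\<close> is twice \<open>trace_offset\<close>, the determinant is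
  \<open>eta_opt l \<gamma> / l\<close>. Larger spikes have smaller \<open>y\<close>.\<close>

definition block_poly :: "real \<Rightarrow> real \<Rightarrow> real \<Rightarrow> real" where
  "block_poly \<gamma> y t = t\<^sup>2 - 2 / y * t + 1 / (2 * y + \<gamma> - 1)"

text \<open>
  The left-hand side is the value of \<open>v\<close> at which \<open>block_poly \<gamma> y v - block_poly \<gamma> z v\<close>
  changes sign.
\<close>

lemma block_poly_root_lower_bound:
  fixes \<gamma> y z v :: real
  assumes \<gamma>: "\<gamma> > 0" "\<gamma>\<^sup>2 + \<gamma> > 1"
    and y: "1 \<le> z" "z \<le> y"
    and root: "block_poly \<gamma> z v = 0" "v > 0" and one: "block_poly \<gamma> z 1 \<le> 0"
  shows "y / (2 * y + \<gamma> - 1) * (z / (2 * z + \<gamma> - 1)) \<le> v"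
proof (cases "\<gamma> \<ge> 1")
  case True
  \<comment> \<open>For \<gamma> \<ge> 1 a crude estimate suffices: the first factor is at most 1/2,
    and dropping the square from the equation of the root bounds the second by
    \<open>2 * v\<close>.\<close>
  have "y / (2 * y + \<gamma> - 1) \<le> 1 / 2"
    using True y by (simp add: field_simps)
  moreover have "0 \<le> z / (2 * z + \<gamma> - 1)"
    using True y by (simp add: field_simps)
  ultimately have "y / (2 * y + \<gamma> - 1) * (z / (2 * z + \<gamma> - 1)) \<le> 1 / 2 * (z / (2 * z + \<gamma> - 1))"
    by (rule mult_right_mono)
  also have "\<dots> \<le> v"
  proof -
    have "1 / (2 * z + \<gamma> - 1) \<le> 2 / z * v"
      using root(1) zero_le_power2[of v] unfolding block_poly_def by linarith
    then have "z * (1 / (2 * z + \<gamma> - 1)) \<le> z * (2 / z * v)"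
      using y by (intro mult_left_mono) auto
    then have "z / (2 * z + \<gamma> - 1) \<le> 2 * v"
      using y by simp
    then show ?thesis
      by linarith
  qed
  finally show ?thesis .
next
  case False
  \<comment> \<open>For \<gamma> < 1 the quotient \<open>y / (2 * y + \<gamma> - 1)\<close>
    decreases in \<open>y\<close>, so \<open>z\<close> may replace \<open>y\<close>, which leaves
    the square \<open>B\<close>.\<close>
  define w where "w = 2 * z + \<gamma> - 1"
  define B where "B = (z / w)\<^sup>2"
  have w: "w > 0" "z \<le> w"
    using y \<gamma> by (auto simp: w_def)
  have "y / (2 * y + \<gamma> - 1) \<le> z / w"
  proof -
    have "y * (\<gamma> - 1) \<le> z * (\<gamma> - 1)"
      using False y by (intro mult_right_mono_neg) auto
    then have "y * w \<le> z * (2 * y + \<gamma> - 1)"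
      by (simp add: w_def algebra_simps)
    then show ?thesis
      using w y \<gamma> by (simp add: divide_le_eq le_divide_eq mult.commute)
  qed
  then have "y / (2 * y + \<gamma> - 1) * (z / (2 * z + \<gamma> - 1)) \<le> B"
    unfolding B_def power2_eq_square w_def[symmetric] using w y by (intro mult_right_mono) auto
  \<comment> \<open>Otherwise \<open>B\<close> lies between the root \<open>v\<close> and 1, and 1
    lies between the roots, so the quadratic is nonpositive at \<open>B\<close>. Its value there,
    however, is the positive quartic over \<open>w ^ 4\<close>.\<close>
  also have "B \<le> v"
  proof (rule ccontr)
    assume "\<not> B \<le> v"
    then have Bv: "v < B"
      by simp
    have B1: "B \<le> 1"
      using w y by (simp add: B_def power_le_one)
    have fac: "block_poly \<gamma> z t = (t - v) * (t - (2 / z - v))" for t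
      using root(1) unfolding block_poly_def by (rule quadratic_factor)
    have "1 \<le> 2 / z - v"
      using one Bv B1 unfolding fac by (simp add: mult_le_0_iff)
    then have "block_poly \<gamma> z B \<le> 0"
      using Bv B1 unfolding fac by (simp add: mult_le_0_iff)
    moreover have "block_poly \<gamma> z B = (z ^ 4 + (\<gamma> - 1) * (2 * z + \<gamma> - 1)\<^sup>2) / w ^ 4"
    proof -
      have z: "z > 0"
        using y by simp
      have "block_poly \<gamma> z B = (z ^ 4 - 2 * z * w\<^sup>2 + w ^ 3) / w ^ 4"
        using w z unfolding block_poly_def B_def w_def[symmetric]
        by (simp add: field_simps power2_eq_square power3_eq_cube power4_eq_xxxx)
      also have "z ^ 4 - 2 * z * w\<^sup>2 + w ^ 3 = z ^ 4 + (w - 2 * z) * w\<^sup>2"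
        by (simp add: power2_eq_square power3_eq_cube algebra_simps)
      finally show ?thesis
        by (simp add: w_def)
    qed
    moreover have "\<dots> > 0"
      using quartic_pos[of \<gamma> z] \<gamma> False y w by simp
    ultimately show False
      by simp
  qed
  finally show ?thesis .
qed

text \<open>The squares cancel, so the two quadratics differ by an affine function of
  \<open>v\<close>: a nonnegative slope times the distance of \<open>v\<close> from the preceding
  lower bound. Thus no root for the larger spike lies strictly between the roots for the smaller
  one.\<close>

lemma block_poly_mono:
  fixes \<gamma> y z v :: real
  assumes \<gamma>: "\<gamma> > 0" "\<gamma>\<^sup>2 + \<gamma> > 1"
    and y: "1 \<le> z" "z \<le> y"
    and root: "block_poly \<gamma> z v = 0" "v > 0" and one: "block_poly \<gamma> z 1 \<le> 0"
  shows "block_poly \<gamma> y v \<ge> 0"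
proof -
  define p where "p = 2 * y + \<gamma> - 1"
  define q where "q = 2 * z + \<gamma> - 1"
  have pos: "y > 0" "z > 0" "p > 0" "q > 0"
    using y \<gamma> by (auto simp: p_def q_def)
  have "block_poly \<gamma> y v = block_poly \<gamma> y v - block_poly \<gamma> z v"
    using root(1) by simp
  also have "\<dots> = (2 / z - 2 / y) * v + (1 / p - 1 / q)"
    by (simp add: block_poly_def p_def q_def algebra_simps)
  also have "1 / p - 1 / q = - (2 * (y - z) / (p * q))"
  proof -
    have "1 / p - 1 / q = (q - p) / (p * q)"
      using pos by (simp add: field_simps)
    also have "q - p = - (2 * (y - z))"
      by (simp add: p_def q_def)
    finally show ?thesis
      by (simp only: minus_divide_left)
  qed
  also have "(2 / z - 2 / y) * v + - (2 * (y - z) / (p * q)) = 2 * (y - z) / (y * z) * (v - y / p * (z / q))"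
    using pos by (simp add: field_simps)
  finally have "block_poly \<gamma> y v = 2 * (y - z) / (y * z) * (v - y / p * (z / q))" .
  moreover have "2 * (y - z) / (y * z) \<ge> 0"
    using pos y by simp
  moreover have "v - y / p * (z / q) \<ge> 0"
    using block_poly_root_lower_bound[OF assms] by (simp add: p_def q_def)
  ultimately show ?thesis
    by (metis mult_nonneg_nonneg)
qed

text \<open>The value at 1 puts 1 between the roots. A point left of 1 with nonnegative value is
  then left of both roots, and symmetrically on the right.\<close>

lemma quadratic_root_bounds:
  fixes b c t u w :: real
  assumes t: "t\<^sup>2 - b * t + c = 0" and "1 - b + c \<le> 0"
    and "u\<^sup>2 - b * u + c \<ge> 0" "w\<^sup>2 - b * w + c \<ge> 0" and "u < 1" "1 < w"
  shows "u \<le> t" "t \<le> w"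
proof -
  have fac: "s\<^sup>2 - b * s + c = (s - t) * (s - (b - t))" for s
    using t by (rule quadratic_factor)
  have one: "(1 - t) * (1 - (b - t)) \<le> 0"
    using assms(2) fac[of 1] by simp
  show "u \<le> t"
  proof (rule ccontr)
    assume *: "\<not> u \<le> t"
    then have "1 \<le> b - t"
      using one \<open>u < 1\<close> by (simp add: mult_le_0_iff)
    then have "(u - t) * (u - (b - t)) < 0"
      using * \<open>u < 1\<close> by (intro mult_pos_neg) auto
    then show False
      using assms(3) fac[of u] by simp
  qed
  show "t \<le> w"
  proof (rule ccontr)
    assume *: "\<not> t \<le> w"
    then have "b - t \<le> 1"
      using one \<open>1 < w\<close> by (simp add: mult_le_0_iff)
    then have "(w - t) * (w - (b - t)) < 0"
      using * \<open>1 < w\<close> by (intro mult_neg_pos) auto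
    then show False
      using assms(4) fac[of w] by simp
  qed
qed

text \<open>For \<open>k = w / u\<close> the quotient \<open>(u + w)\<^sup>2 / (u * w)\<close> is
  \<open>k + 2 + 1 / k\<close>, increasing for \<open>k \<ge> 1\<close>. Without division, the
  difference of the two sides factors as \<open>(w * v - u * z) * (w * z - u * v)\<close>.\<close>

lemma ratio_le_of_sum_square_le:
  fixes u v w z :: real
  assumes pos: "0 < u" "u \<le> w" "0 < v" "v \<le> z"
    and le: "(v + z)\<^sup>2 * (u * w) \<le> (u + w)\<^sup>2 * (v * z)"
  shows "z / v \<le> w / u"
proof -
  have "(w * v - u * z) * (w * z - u * v) \<ge> 0"
    using le by (simp add: power2_eq_square algebra_simps)
  moreover have uv: "u * v \<le> w * z"
    using pos by (intro mult_mono) auto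
  ultimately have "u * z \<le> w * v"
  \<comment> \<open>If the second factor vanishes, the sign of the product says nothing, and the
    ordering of the four numbers decides instead.\<close>
  proof (cases "u * v = w * z")
    case True
    have "u * v \<le> w * v" "w * v \<le> w * z" "u * v \<le> u * z" "u * z \<le> w * z"
      using pos by (auto intro: mult_left_mono mult_right_mono)
    then show ?thesis
      using True by linarith
  next
    case False
    then show ?thesis
      using uv \<open>(w * v - u * z) * (w * z - u * v) \<ge> 0\<close> by (simp add: zero_le_mult_iff)
  qed
  then show ?thesis
    using pos by (simp add: field_simps)
qed

section \<open>The blocks of the asymptotic pivot\<close>

text \<open>The trace of \<open>pivot_block l \<eta> \<gamma>\<close> is \<open>trace_offset l \<gamma> + trace_slope l \<gamma> * \<eta>\<close>.\<close>

definition trace_offset :: "real \<Rightarrow> real \<Rightarrow> real" where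
  "trace_offset l \<gamma> = (sine l \<gamma>)\<^sup>2 / l + (cosine l \<gamma>)\<^sup>2"

definition trace_slope :: "real \<Rightarrow> real \<Rightarrow> real" where
  "trace_slope l \<gamma> = (cosine l \<gamma>)\<^sup>2 / l + (sine l \<gamma>)\<^sup>2"

text \<open>Beyond \<open>ell_plus \<gamma>\<close> one has
  \<open>(l - 1)\<^sup>2 \<ge> \<gamma>\<close>, so the radicand is nonnegative and squaring undoes
  the root.\<close>

lemma cosine_bounds:
  assumes "\<gamma> > 0" "l > 1"
  shows "0 \<le> cosine l \<gamma>" "(cosine l \<gamma>)\<^sup>2 \<le> 1"
    "l > ell_plus \<gamma> \<Longrightarrow> (cosine l \<gamma>)\<^sup>2 = ((l - 1)\<^sup>2 - \<gamma>) / ((l - 1) * (l - 1 + \<gamma>))"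
proof -
  define x where "x = l - 1"
  have x: "x > 0"
    using assms by (simp add: x_def)
  have *: "(1 - \<gamma> / x\<^sup>2) / (1 + \<gamma> / x) = (x\<^sup>2 - \<gamma>) / (x * (x + \<gamma>))"
    using x assms by (simp add: divide_simps power2_eq_square)
  have ge: "x\<^sup>2 \<ge> \<gamma>" if "l > ell_plus \<gamma>"
  proof -
    have "(sqrt \<gamma>)\<^sup>2 \<le> x\<^sup>2"
      using that assms by (intro power_mono) (auto simp: ell_plus_def x_def)
    then show ?thesis
      using assms by simp
  qed
  then have nonneg: "(x\<^sup>2 - \<gamma>) / (x * (x + \<gamma>)) \<ge> 0" if "l > ell_plus \<gamma>"
    using that x assms by simp
  then show "0 \<le> cosine l \<gamma>"
    unfolding cosine_def x_def[symmetric] * by simp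
  show eq: "(cosine l \<gamma>)\<^sup>2 = ((l - 1)\<^sup>2 - \<gamma>) / ((l - 1) * (l - 1 + \<gamma>))" if "l > ell_plus \<gamma>"
    using nonneg that unfolding cosine_def x_def[symmetric] * by simp
  have "(x\<^sup>2 - \<gamma>) / (x * (x + \<gamma>)) \<le> 1"
  proof -
    have "x\<^sup>2 - \<gamma> \<le> x * (x + \<gamma>)"
      using x assms mult_pos_pos[of x \<gamma>] by (simp add: power2_eq_square algebra_simps)
    then show ?thesis
      using x assms by (simp add: divide_le_eq)
  qed
  then show "(cosine l \<gamma>)\<^sup>2 \<le> 1"
    using eq by (cases "l > ell_plus \<gamma>") (auto simp: x_def cosine_def)
qed

lemma sine_square:
  assumes "\<gamma> > 0" "l > 1"
  shows "(sine l \<gamma>)\<^sup>2 = 1 - (cosine l \<gamma>)\<^sup>2"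
  using cosine_bounds[OF assms] by (simp add: sine_def)

text \<open>At \<eta> = 1 the block is diagonal with entries \<open>1 / l\<close> and 1, whatever
  the angle.\<close>

lemma trace_offset_plus_slope:
  assumes "\<gamma> > 0" "l > 1"
  shows "trace_offset l \<gamma> + trace_slope l \<gamma> = 1 + 1 / l"
  using assms by (simp add: trace_offset_def trace_slope_def sine_square field_simps)

lemma trace_coeffs_above:
  assumes "\<gamma> > 0" "l > ell_plus \<gamma>"
  shows "trace_offset l \<gamma> = (l - 1) / (l - 1 + \<gamma>)"
    and "trace_slope l \<gamma> = ((1 + \<gamma>) * (l - 1) + 2 * \<gamma>) / (l * (l - 1 + \<gamma>))"
proof -
  have l: "l > 1"
    using assms by (smt (verit) ell_plus_def real_sqrt_gt_zero)
  define x where "x = l - 1"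
  have x: "x > 0" "l = 1 + x"
    using l by (auto simp: x_def)
  have c: "(cosine l \<gamma>)\<^sup>2 = (x\<^sup>2 - \<gamma>) / (x * (x + \<gamma>))"
    using cosine_bounds(3)[OF assms(1) l assms(2)] by (simp add: x_def)
  have s: "(sine l \<gamma>)\<^sup>2 = \<gamma> * (1 + x) / (x * (x + \<gamma>))"
  proof -
    have "x * (x + \<gamma>) \<noteq> 0"
      using x assms by simp
    then have "(sine l \<gamma>)\<^sup>2 = (x * (x + \<gamma>) - (x\<^sup>2 - \<gamma>)) / (x * (x + \<gamma>))"
      unfolding sine_square[OF assms(1) l] c diff_divide_distrib by simp
    also have "x * (x + \<gamma>) - (x\<^sup>2 - \<gamma>) = \<gamma> * (1 + x)"
      by (simp add: power2_eq_square algebra_simps)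
    finally show ?thesis .
  qed
  have "trace_offset l \<gamma> = (\<gamma> + (x\<^sup>2 - \<gamma>)) / (x * (x + \<gamma>))"
    unfolding trace_offset_def c s add_divide_distrib using x by simp
  also have "\<dots> = x / (x + \<gamma>)"
    using x by (simp add: power2_eq_square)
  finally show a: "trace_offset l \<gamma> = (l - 1) / (l - 1 + \<gamma>)"
    by (simp add: x_def)
  \<comment> \<open>The slope is read off from the known sum, which avoids a second
    expansion.\<close>
  have "trace_slope l \<gamma> = 1 + 1 / l - x / (x + \<gamma>)"
    using trace_offset_plus_slope[OF assms(1) l] a by (simp add: x_def)
  also have "\<dots> = ((1 + \<gamma>) * x + 2 * \<gamma>) / (l * (x + \<gamma>))"
    unfolding x(2) using x(1) assms(1) by (simp add: field_simps)
  finally show "trace_slope l \<gamma> = ((1 + \<gamma>) * (l - 1) + 2 * \<gamma>) / (l * (l - 1 + \<gamma>))"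
    by (simp add: x_def)
qed

lemma trace_coeffs_pos:
  assumes "\<gamma> > 0" "l > 1"
  shows "trace_offset l \<gamma> > 0" "trace_slope l \<gamma> > 0"
proof -
  define C where "C = (cosine l \<gamma>)\<^sup>2"
  have C: "0 \<le> C" "C \<le> 1"
    using cosine_bounds[OF assms] by (simp_all add: C_def)
  have eq: "trace_offset l \<gamma> = (1 - C) / l + C" "trace_slope l \<gamma> = C / l + (1 - C)"
    by (simp_all add: trace_offset_def trace_slope_def sine_square[OF assms] C_def)
  show "trace_offset l \<gamma> > 0"
    unfolding eq using C assms by (cases "C = 0") (auto intro: add_nonneg_pos)
  show "trace_slope l \<gamma> > 0"
    unfolding eq using C assms by (cases "C = 1") (auto intro: add_nonneg_pos)
qed

text \<open>Since \<open>c\<^sup>2 + s\<^sup>2 = 1\<close>, the determinant is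
  \<open>\<eta> / l\<close> regardless of the angle. Trace and determinant are positive, so the
  block is positive definite; its singular values are recorded by sum and product for the AM-GM
  comparison.\<close>

lemma singular_values_pivot_block:
  assumes "\<gamma> > 0" "l > 1" "\<eta> > 0"
  obtains u w where "0 < u" "u \<le> w" "u + w = trace_offset l \<gamma> + trace_slope l \<gamma> * \<eta>" "u * w = \<eta> / l"
    "singular_values (pivot_block l \<eta> \<gamma>) = {u, w}"
proof -
  define c s where "c = cosine l \<gamma>" and "s = sine l \<gamma>"
  have s: "s\<^sup>2 = 1 - c\<^sup>2"
    using sine_square[OF assms(1,2)] by (simp add: c_def s_def)
  define p q t where "p = (\<eta> * c\<^sup>2 + s\<^sup>2) / l" and "q = c\<^sup>2 + \<eta> * s\<^sup>2" and "t = (\<eta> - 1) * c * s / sqrt l"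
  define T where "T = trace_offset l \<gamma> + trace_slope l \<gamma> * \<eta>"
  have T: "p + q = T"
    by (simp add: p_def q_def T_def trace_offset_def trace_slope_def c_def s_def algebra_simps add_divide_distrib)
  have "T > 0"
    using trace_coeffs_pos[OF assms(1,2)] assms(3) by (simp add: T_def add_pos_pos)
  have "t\<^sup>2 = ((\<eta> - 1)\<^sup>2 * c\<^sup>2 * s\<^sup>2) / l"
    using assms by (simp add: t_def power_divide power_mult_distrib)
  then have "p * q - t\<^sup>2 = ((\<eta> * c\<^sup>2 + s\<^sup>2) * (c\<^sup>2 + \<eta> * s\<^sup>2) - (\<eta> - 1)\<^sup>2 * c\<^sup>2 * s\<^sup>2) / l"
    by (simp add: p_def q_def diff_divide_distrib)
  also have "(\<eta> * c\<^sup>2 + s\<^sup>2) * (c\<^sup>2 + \<eta> * s\<^sup>2) - (\<eta> - 1)\<^sup>2 * c\<^sup>2 * s\<^sup>2 = \<eta> * (c\<^sup>2 + s\<^sup>2)\<^sup>2"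
    by (simp add: power2_eq_square algebra_simps)
  finally have D: "p * q - t\<^sup>2 = \<eta> / l"
    using s by simp
  have "\<eta> / l > 0"
    using assms by simp
  \<comment> \<open>The discriminant of a symmetric block is a sum of squares, so the roots are
    real.\<close>
  have "T\<^sup>2 - 4 * (\<eta> / l) = (p - q)\<^sup>2 + 4 * t\<^sup>2"
    by (simp add: D[symmetric] T[symmetric] power2_eq_square algebra_simps)
  then have disc: "T\<^sup>2 - 4 * (\<eta> / l) \<ge> 0"
    by simp
  define r where "r = sqrt (T\<^sup>2 - 4 * (\<eta> / l))"
  have r: "r \<ge> 0" "r\<^sup>2 = T\<^sup>2 - 4 * (\<eta> / l)"
    using disc by (simp_all add: r_def)
  define u w where "u = (T - r) / 2" and "w = (T + r) / 2"
  have sum: "u + w = T"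
    by (simp add: u_def w_def field_simps)
  have "4 * (u * w) = T\<^sup>2 - r\<^sup>2"
    by (simp add: u_def w_def power2_eq_square square_diff_square_factored)
  then have prod: "u * w = \<eta> / l"
    using r by simp
  have "u \<le> w"
    using r by (simp add: u_def w_def)
  have "w > 0"
    using r \<open>T > 0\<close> by (simp add: w_def)
  then have "u > 0"
    using prod \<open>\<eta> / l > 0\<close> by (metis zero_less_mult_pos2)
  have "pivot_block l \<eta> \<gamma> = mat_of_rows_list 2 [[p, t], [t, q]]"
    by (simp add: pivot_block_def Let_def p_def q_def t_def c_def s_def)
  then have "singular_values (pivot_block l \<eta> \<gamma>) = {x. x\<^sup>2 - T * x + \<eta> / l = 0}"
    using singular_values_symmetric_2[of p q t] T D \<open>T > 0\<close> \<open>\<eta> / l > 0\<close> by simp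
  also have "x\<^sup>2 - T * x + \<eta> / l = (x - u) * (x - w)" for x
    by (simp add: sum[symmetric] prod[symmetric] power2_eq_square algebra_simps)
  then have "{x. x\<^sup>2 - T * x + \<eta> / l = 0} = {u, w}"
    by auto
  finally show ?thesis
    using that \<open>0 < u\<close> \<open>u \<le> w\<close> sum prod by (simp add: T_def)
qed

text \<open>The identity block has positive size \<open>p - 2 * r\<close> and contributes the
  singular value 1.\<close>

lemma singular_values_asymptotic_pivot:
  assumes "p > 2 * r"
  shows "singular_values (asymptotic_pivot p r \<gamma> l \<eta>) =
    insert 1 (\<Union>i\<in>{1..r}. singular_values (pivot_block (l i) (\<eta> i) \<gamma>))"
proof -
  have "square_mat (pivot_block (l i) (\<eta> i) \<gamma>)" for i
    by (simp add: pivot_block_def Let_def mat_of_rows_list_def)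
  moreover have "set [1..<r + 1] = {1..r}"
    by auto
  ultimately show ?thesis
    using assms singular_values_one[of "p - 2 * r"]
    by (simp add: asymptotic_pivot_def singular_values_diag_block_mat del: set_upt upt_Suc)
qed

section \<open>The threshold \<open>ell1_plus\<close> and the single-spike optimum\<close>

lemma ell_plus_less_ell1_plus:
  assumes "\<gamma> > 0"
  shows "ell_plus \<gamma> < ell1_plus \<gamma>"
proof -
  have "sqrt (4 * \<gamma>) < sqrt (\<gamma>\<^sup>2 + 8 * \<gamma>)"
    using assms by (auto simp: add_nonneg_pos)
  then show ?thesis
    using assms by (simp add: ell_plus_def ell1_plus_def real_sqrt_mult)
qed

text \<open>\<open>ell1_plus \<gamma> - 1\<close> is the positive root of
  \<open>x\<^sup>2 - \<gamma> * x - 2 * \<gamma>\<close>. Above \<open>ell_plus \<gamma>\<close> the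
  inequality expresses that \<open>trace_offset\<close> exceeds \<open>trace_slope\<close>.\<close>

lemma less_ell1_plus_iff:
  assumes "\<gamma> > 0" "l > 1"
  shows "ell1_plus \<gamma> < l \<longleftrightarrow> \<gamma> * (l - 1) + 2 * \<gamma> < (l - 1)\<^sup>2"
proof -
  define x where "x = l - 1"
  define R where "R = sqrt (\<gamma>\<^sup>2 + 8 * \<gamma>)"
  have R: "R \<ge> 0" "R\<^sup>2 = \<gamma>\<^sup>2 + 8 * \<gamma>"
    using assms by (simp_all add: R_def)
  have "sqrt (\<gamma>\<^sup>2) \<le> R"
    unfolding R_def using assms by (intro real_sqrt_le_mono) auto
  then have "\<gamma> \<le> R"
    using assms by simp
  have "x\<^sup>2 - (\<gamma> * x + 2 * \<gamma>) = (x - (\<gamma> + R) / 2) * (x + (R - \<gamma>) / 2) + (R\<^sup>2 - \<gamma>\<^sup>2 - 8 * \<gamma>) / 4"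
    by (simp add: power2_eq_square field_simps)
  then have "x\<^sup>2 - (\<gamma> * x + 2 * \<gamma>) = (x - (\<gamma> + R) / 2) * (x + (R - \<gamma>) / 2)"
    using R by simp
  moreover have "x + (R - \<gamma>) / 2 > 0"
    using assms \<open>\<gamma> \<le> R\<close> by (intro add_pos_nonneg) (auto simp: x_def)
  ultimately have "\<gamma> * x + 2 * \<gamma> < x\<^sup>2 \<longleftrightarrow> (\<gamma> + R) / 2 < x"
    by (smt (verit) zero_less_mult_iff)
  moreover have "ell1_plus \<gamma> < l \<longleftrightarrow> (\<gamma> + R) / 2 < x"
    unfolding ell1_plus_def R_def x_def by linarith
  ultimately show ?thesis
    by (simp add: x_def)
qed

text \<open>The nontrivial branch of \<open>eta1_star\<close>, as a function of the spike instead of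
  the eigenvalue.\<close>

definition eta_opt :: "real \<Rightarrow> real \<Rightarrow> real" where
  "eta_opt l \<gamma> = l / (1 + \<gamma> + 2 * \<gamma> / (l - 1))"

text \<open>With \<open>x = l - 1\<close> and \<open>g = \<gamma> / x\<close> the eigenvalue is
  \<open>(1 + x) * (1 + g)\<close>, symmetric in \<open>x\<close> and \<open>g\<close>; the plus
  sign in \<open>ell_of\<close> selects the larger, which is \<open>x\<close> above
  \<open>ell_plus \<gamma>\<close>. At or below it, \<open>lambda_of\<close> returns
  \<open>lambda_plus \<gamma>\<close>, and the strict guard yields 1.\<close>

lemma eta1_star_lambda_of:
  assumes "\<gamma> > 0" "l > 1"
  shows "eta1_star (lambda_of l \<gamma>) \<gamma> =
    (if l > ell1_plus \<gamma> then eta_opt l \<gamma> else 1)"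
proof (cases "l > ell_plus \<gamma>")
  case False
  then show ?thesis
    using ell_plus_less_ell1_plus[OF assms(1)] by (simp add: eta1_star_def lambda_of_def)
next
  case True
  define x where "x = l - 1"
  have x: "x > 0" "l = 1 + x" "x > sqrt \<gamma>"
    using assms True by (auto simp: x_def ell_plus_def)
  define g where "g = \<gamma> / x"
  have g: "\<gamma> = g * x" "g > 0"
    using x assms by (auto simp: g_def)
  have lam: "lambda_of l \<gamma> = (1 + x) * (1 + g)"
    using True by (simp add: lambda_of_def x(2) g_def)
  have "(sqrt \<gamma>)\<^sup>2 < x\<^sup>2"
    using x assms by (intro power_strict_mono) auto
  then have "g * x < x * x"
    using assms g by (simp add: power2_eq_square)
  then have "g < x"
    using x by simp
  have "lambda_of l \<gamma> - lambda_plus \<gamma> = (sqrt x - sqrt g)\<^sup>2"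
  proof -
    have "sqrt \<gamma> = sqrt g * sqrt x"
      unfolding g(1) by (rule real_sqrt_mult)
    then show ?thesis
      unfolding lam lambda_plus_def using x g(2)
      by (simp add: power2_sum power2_diff power_mult_distrib) (simp add: algebra_simps)
  qed
  moreover have "(sqrt x - sqrt g)\<^sup>2 > 0"
    using \<open>g < x\<close> by simp
  ultimately have gt: "lambda_of l \<gamma> > lambda_plus \<gamma>"
    by linarith
  have "ell_of (lambda_of l \<gamma>) \<gamma> = l"
  proof -
    have e: "lambda_of l \<gamma> + 1 - \<gamma> = 2 + x + g"
      unfolding lam unfolding g(1) by (simp add: algebra_simps)
    have "(2 + x + g)\<^sup>2 - 4 * lambda_of l \<gamma> = (x - g)\<^sup>2"
      unfolding lam by (simp add: power2_eq_square algebra_simps)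
    then show ?thesis
      unfolding ell_of_def e using \<open>g < x\<close> x by simp
  qed
  then show ?thesis
    using gt by (simp add: eta1_star_def eta_opt_def Let_def)
qed

lemma singular_values_pivot_block_one:
  assumes "\<gamma> > 0" "l > 1"
  shows "singular_values (pivot_block l 1 \<gamma>) = {1 / l, 1}"
proof -
  have "(1::real) > 0"
    by simp
  then obtain u w where uw: "u + w = trace_offset l \<gamma> + trace_slope l \<gamma> * 1" "u * w = 1 / l"
    "singular_values (pivot_block l 1 \<gamma>) = {u, w}"
    by (rule singular_values_pivot_block[OF assms])
  have sum: "u + w = 1 + 1 / l"
    using uw(1) trace_offset_plus_slope[OF assms] by simp
  then have "(1 - u) * (1 - w) = 0"
    using uw(2) by (simp add: algebra_simps)
  then have "u = 1 \<or> w = 1"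
    by simp
  then have "u = 1 \<and> w = 1 / l \<or> u = 1 / l \<and> w = 1"
    using sum by linarith
  then show ?thesis
    using uw(3) by (metis insert_commute)
qed

text \<open>The optimum balances the two terms of the trace, which is the equality case of AM-GM;
  the trace is then twice the offset, hence \<open>2 / y\<close> in the variable of
  \<open>block_poly\<close>.\<close>

lemma eta_opt:
  assumes "\<gamma> > 0" "l > ell_plus \<gamma>"
  shows "eta_opt l \<gamma> > 0"
    and "trace_offset l \<gamma> = trace_slope l \<gamma> * eta_opt l \<gamma>"
    and "t\<^sup>2 - (trace_offset l \<gamma> + trace_slope l \<gamma> * eta_opt l \<gamma>) * t + eta_opt l \<gamma> / l =
      block_poly \<gamma> (1 + \<gamma> / (l - 1)) t"
proof -
  have l: "l > 1"
    using assms by (smt (verit) ell_plus_def real_sqrt_gt_zero)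
  define x where "x = l - 1"
  have x: "x > 0" "l = 1 + x"
    using l by (auto simp: x_def)
  have "(1 + \<gamma>) * x + 2 * \<gamma> > 0"
    using x assms by (intro add_pos_pos) auto
  have opt: "eta_opt l \<gamma> = l * x / ((1 + \<gamma>) * x + 2 * \<gamma>)"
    using x by (simp add: eta_opt_def field_simps)
  show pos: "eta_opt l \<gamma> > 0"
    unfolding opt using x l \<open>(1 + \<gamma>) * x + 2 * \<gamma> > 0\<close> by simp
  have a: "trace_offset l \<gamma> = x / (x + \<gamma>)"
    using trace_coeffs_above(1)[OF assms] by (simp add: x_def)
  have b: "trace_slope l \<gamma> = ((1 + \<gamma>) * x + 2 * \<gamma>) / (l * (x + \<gamma>))"
    using trace_coeffs_above(2)[OF assms] by (simp add: x_def)
  show eq: "trace_offset l \<gamma> = trace_slope l \<gamma> * eta_opt l \<gamma>"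
    unfolding a b opt using x l \<open>(1 + \<gamma>) * x + 2 * \<gamma> > 0\<close> by simp
  have "2 / (1 + \<gamma> / x) = 2 * (x / (x + \<gamma>))"
    using x assms by (simp add: field_simps)
  moreover have "2 * (1 + \<gamma> / x) + \<gamma> - 1 = 1 + \<gamma> + 2 * \<gamma> / x"
    by simp
  then have "1 / (2 * (1 + \<gamma> / x) + \<gamma> - 1) = eta_opt l \<gamma> / l"
    using l by (simp add: eta_opt_def x_def)
  ultimately show "t\<^sup>2 - (trace_offset l \<gamma> + trace_slope l \<gamma> * eta_opt l \<gamma>) * t + eta_opt l \<gamma> / l =
      block_poly \<gamma> (1 + \<gamma> / (l - 1)) t"
    unfolding block_poly_def eq[symmetric] a x_def[symmetric] by simp
qed

text \<open>The two branches of the nonlinearity meet at the threshold, because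
  \<open>x = ell1_plus \<gamma> - 1\<close> solves
  \<open>x\<^sup>2 = \<gamma> * x + 2 * \<gamma>\<close>.\<close>

lemma eta_opt_ell1_plus:
  assumes "\<gamma> > 0"
  shows "eta_opt (ell1_plus \<gamma>) \<gamma> = 1"
proof -
  define x where "x = ell1_plus \<gamma> - 1"
  define R where "R = sqrt (\<gamma>\<^sup>2 + 8 * \<gamma>)"
  have R: "R \<ge> 0" "R\<^sup>2 = \<gamma>\<^sup>2 + 8 * \<gamma>"
    using assms by (simp_all add: R_def)
  have x: "x = (\<gamma> + R) / 2" "x > 0"
    using assms R(1) unfolding x_def ell1_plus_def R_def[symmetric] by auto
  have "x\<^sup>2 = (\<gamma>\<^sup>2 + 2 * \<gamma> * R + R\<^sup>2) / 4"
    unfolding x(1) by (simp add: power2_eq_square field_simps)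
  also have "\<dots> = \<gamma> * x + 2 * \<gamma>"
    unfolding R(2) x(1) by (simp add: power2_eq_square field_simps)
  finally have "1 + x = 1 + \<gamma> + 2 * \<gamma> / x"
    using x(2) by (simp add: field_simps power2_eq_square)
  moreover have "ell1_plus \<gamma> = 1 + x"
    by (simp add: x_def)
  ultimately show ?thesis
    using x(2) by (simp add: eta_opt_def)
qed

text \<open>Over a positive denominator the value at 1 has numerator
  \<open>\<gamma> * (\<gamma> * x + 2 * \<gamma> - x\<^sup>2)\<close>, negative past the threshold.
  So 1 lies strictly between the roots.\<close>

lemma block_poly_one_neg:
  assumes "\<gamma> > 0" "l > ell1_plus \<gamma>"
  shows "block_poly \<gamma> (1 + \<gamma> / (l - 1)) 1 < 0"
proof -
  have l: "l > 1"
    using assms ell_plus_less_ell1_plus[OF assms(1)]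
    by (smt (verit) ell_plus_def real_sqrt_gt_zero)
  define x where "x = l - 1"
  have x: "x > 0"
    using l by (simp add: x_def)
  define K where "K = (1 + \<gamma>) * x + 2 * \<gamma>"
  have K: "K > 0"
    unfolding K_def using x assms by (intro add_pos_pos) auto
  have less: "\<gamma> * x + 2 * \<gamma> < x\<^sup>2"
    using less_ell1_plus_iff[OF assms(1) l] assms(2) by (simp add: x_def)
  have "2 / (1 + \<gamma> / x) = 2 * x / (x + \<gamma>)"
    using x assms by (simp add: field_simps)
  moreover have "1 / (2 * (1 + \<gamma> / x) + \<gamma> - 1) = x / K"
    using x K by (simp add: K_def field_simps)
  ultimately have "block_poly \<gamma> (1 + \<gamma> / x) 1 = 1 - 2 * x / (x + \<gamma>) + x / K"
    by (simp add: block_poly_def)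
  also have "\<dots> = ((x + \<gamma>) * K - 2 * x * K + x * (x + \<gamma>)) / ((x + \<gamma>) * K)"
    using x assms K by (simp add: field_simps)
  also have "(x + \<gamma>) * K - 2 * x * K + x * (x + \<gamma>) = \<gamma> * (\<gamma> * x + 2 * \<gamma> - x\<^sup>2)"
    unfolding K_def by (simp add: power2_eq_square algebra_simps)
  finally show ?thesis
    using x assms K less unfolding x_def[symmetric]
    by (simp add: divide_neg_pos mult_pos_neg)
qed

text \<open>By \<open>block_poly_mono\<close>, \<open>u\<close> and \<open>w\<close> do not lie
  strictly between the roots of a smaller shrunk spike, while 1 separates those roots; this forces
  nesting. A spike with \<eta> = 1 is compared through the threshold spike.\<close>

lemma singular_values_pivot_block_nested:
  assumes \<gamma>: "\<gamma> > 0" "\<gamma>\<^sup>2 + \<gamma> > 1"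
    and l: "1 < m" "m \<le> l" "l > ell1_plus \<gamma>"
    and uw: "0 < u" "u \<le> w" "singular_values (pivot_block l (eta_opt l \<gamma>) \<gamma>) = {u, w}"
      "u + w = trace_offset l \<gamma> + trace_slope l \<gamma> * eta_opt l \<gamma>" "u * w = eta_opt l \<gamma> / l"
  defines "\<eta> \<equiv> if m > ell1_plus \<gamma> then eta_opt m \<gamma> else 1"
  shows "u < 1" "1 < w" "singular_values (pivot_block m \<eta> \<gamma>) \<subseteq> {u..w}"
proof -
  have ell: "ell_plus \<gamma> < ell1_plus \<gamma>"
    by (rule ell_plus_less_ell1_plus[OF \<gamma>(1)])
  have ell1: "ell1_plus \<gamma> > 1"
    using ell \<gamma> by (smt (verit) ell_plus_def real_sqrt_gt_zero)
  have lp: "l > ell_plus \<gamma>"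
    using ell l by simp
  have fac: "block_poly \<gamma> (1 + \<gamma> / (l - 1)) t = (t - u) * (t - w)" for t
    unfolding eta_opt(3)[OF \<gamma>(1) lp, symmetric] uw(4)[symmetric] uw(5)[symmetric]
    by (simp add: power2_eq_square algebra_simps)
  have one: "(1 - u) * (1 - w) < 0"
    using block_poly_one_neg[OF \<gamma>(1) l(3)] fac by simp
  then show "u < 1" "1 < w"
    using uw(2) by (auto simp: mult_less_0_iff)
  \<comment> \<open>The range of \<open>n\<close> includes the threshold itself, where
    \<open>eta_opt\<close> is 1 and 1 is a root.\<close>
  have bounds: "u \<le> t \<and> t \<le> w" if n: "ell1_plus \<gamma> \<le> n" "n \<le> l"
      and t: "t \<in> singular_values (pivot_block n (eta_opt n \<gamma>) \<gamma>)" for n t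
  proof -
    have np: "n > ell_plus \<gamma>" "n > 1"
      using n ell ell1 by auto
    obtain u' w' where uw': "u' + w' = trace_offset n \<gamma> + trace_slope n \<gamma> * eta_opt n \<gamma>"
      "u' * w' = eta_opt n \<gamma> / n" "singular_values (pivot_block n (eta_opt n \<gamma>) \<gamma>) = {u', w'}"
      by (rule singular_values_pivot_block[OF \<gamma>(1) np(2) eta_opt(1)[OF \<gamma>(1) np(1)]])
    have fac': "block_poly \<gamma> (1 + \<gamma> / (n - 1)) t = (t - u') * (t - w')" for t
      unfolding eta_opt(3)[OF \<gamma>(1) np(1), symmetric] uw'(1)[symmetric] uw'(2)[symmetric]
      by (simp add: power2_eq_square algebra_simps)
    have "block_poly \<gamma> (1 + \<gamma> / (n - 1)) 1 \<le> 0"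
    proof (cases "n = ell1_plus \<gamma>")
      case True
      then have "{u', w'} = {1 / n, 1}"
        using singular_values_pivot_block_one[OF \<gamma>(1) np(2)] eta_opt_ell1_plus[OF \<gamma>(1)] uw'(3) by simp
      then have "1 \<in> {u', w'}"
        by blast
      then show ?thesis
        unfolding fac' by auto
    next
      case False
      then show ?thesis
        using block_poly_one_neg[OF \<gamma>(1), of n] n by simp
    qed
    moreover have "block_poly \<gamma> (1 + \<gamma> / (n - 1)) v \<ge> 0" if "v \<in> {u, w}" for v
    proof (rule block_poly_mono[OF \<gamma>])
      show "1 \<le> 1 + \<gamma> / (l - 1)"
        using \<gamma> l by simp
      show "1 + \<gamma> / (l - 1) \<le> 1 + \<gamma> / (n - 1)"
        using \<gamma> n np by (simp add: divide_left_mono)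
      show "block_poly \<gamma> (1 + \<gamma> / (l - 1)) v = 0" "v > 0" "block_poly \<gamma> (1 + \<gamma> / (l - 1)) 1 \<le> 0"
        using that uw one by (auto simp: fac)
    qed
    moreover have "block_poly \<gamma> (1 + \<gamma> / (n - 1)) t = 0"
      using t uw'(3) by (auto simp: fac')
    ultimately show ?thesis
      using quadratic_root_bounds[of t "2 / (1 + \<gamma> / (n - 1))" "1 / (2 * (1 + \<gamma> / (n - 1)) + \<gamma> - 1)" u w]
        \<open>u < 1\<close> \<open>1 < w\<close> unfolding block_poly_def by simp
  qed
  show "singular_values (pivot_block m \<eta> \<gamma>) \<subseteq> {u..w}"
  proof (cases "m > ell1_plus \<gamma>")
    case True
    then show ?thesis
      using bounds[of m] l by (auto simp: \<eta>_def)
  next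
    case False
    \<comment> \<open>The block of \<open>m\<close> has singular values \<open>1 / m\<close> and 1;
      the threshold block has \<open>1 / ell1_plus \<gamma>\<close>, which is at least
      \<open>u\<close> and at most \<open>1 / m\<close>.\<close>
    have "1 / ell1_plus \<gamma> \<in> singular_values (pivot_block (ell1_plus \<gamma>) (eta_opt (ell1_plus \<gamma>) \<gamma>) \<gamma>)"
      by (simp add: eta_opt_ell1_plus[OF \<gamma>(1)] singular_values_pivot_block_one[OF \<gamma>(1) ell1])
    then have "u \<le> 1 / ell1_plus \<gamma>"
      using bounds[of "ell1_plus \<gamma>"] l by auto
    also have "\<dots> \<le> 1 / m"
      using False l by (simp add: frac_le)
    finally show ?thesis
      using False l \<open>u < 1\<close> \<open>1 < w\<close> singular_values_pivot_block_one[OF \<gamma>(1) l(1)]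
      by (auto simp: \<eta>_def intro: order_trans[of _ 1])
  qed
qed

section \<open>Bounds on the condition number from the set of singular values\<close>

lemma singular_values_asymptotic_pivot_finite_pos:
  assumes "\<gamma> > 0" "p > 2 * r" "\<forall>i\<in>{1..r}. l i > 1" "\<forall>i\<in>{1..r}. \<eta> i > 0"
  shows "finite (singular_values (asymptotic_pivot p r \<gamma> l \<eta>))"
    and "\<forall>t\<in>singular_values (asymptotic_pivot p r \<gamma> l \<eta>). t > 0"
proof -
  have "finite (singular_values (pivot_block (l i) (\<eta> i) \<gamma>)) \<and>
      (\<forall>t\<in>singular_values (pivot_block (l i) (\<eta> i) \<gamma>). t > 0)" if "i \<in> {1..r}" for i
  proof -
    have "l i > 1" "\<eta> i > 0"
      using assms(3,4) that by auto
    then obtain u w where "0 < u" "u \<le> w" "singular_values (pivot_block (l i) (\<eta> i) \<gamma>) = {u, w}"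
      by (rule singular_values_pivot_block[OF assms(1)])
    then show ?thesis
      by auto
  qed
  then show "finite (singular_values (asymptotic_pivot p r \<gamma> l \<eta>))"
    and "\<forall>t\<in>singular_values (asymptotic_pivot p r \<gamma> l \<eta>). t > 0"
    unfolding singular_values_asymptotic_pivot[OF assms(2)] by auto
qed

lemma condition_number_ge:
  assumes "finite (singular_values M)" "\<forall>t\<in>singular_values M. t > 0"
    and "u \<in> singular_values M" "w \<in> singular_values M"
  shows "w / u \<le> condition_number M"
proof -
  have "Min (singular_values M) > 0"
    using assms by (metis Min_in empty_iff)
  then show ?thesis
    unfolding condition_number_def using assms
    by (intro frac_le) (auto intro: order_trans[OF less_imp_le Max_ge])
qed

lemma condition_number_le:
  assumes "finite (singular_values M)" "singular_values M \<noteq> {}" "singular_values M \<subseteq> {u..w}" "u > 0"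
  shows "condition_number M \<le> w / u"
proof -
  have "Min (singular_values M) \<in> singular_values M" "Max (singular_values M) \<in> singular_values M"
    using assms by auto
  then show ?thesis
    unfolding condition_number_def using assms by (intro frac_le) (force simp: subset_iff)+
qed

section \<open>Optimality\<close>

lemma trace_slope_le_one:
  assumes "\<gamma> > 0" "l > 1"
  shows "trace_slope l \<gamma> \<le> 1"
proof -
  have "(cosine l \<gamma>)\<^sup>2 / l \<le> (cosine l \<gamma>)\<^sup>2"
    using assms by (simp add: divide_le_eq mult_le_cancel_left1)
  then show ?thesis
    by (simp add: trace_slope_def sine_square[OF assms])
qed

text \<open>Above \<open>ell_plus \<gamma>\<close> this is the quadratic inequality behind
  \<open>ell1_plus\<close>; otherwise the cosine is 0 and the claim reads
  \<open>1 / l \<le> 1\<close>.\<close>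

lemma trace_offset_le_slope:
  assumes "\<gamma> > 0" "l > 1" "l \<le> ell1_plus \<gamma>"
  shows "trace_offset l \<gamma> \<le> trace_slope l \<gamma>"
proof (cases "l > ell_plus \<gamma>")
  case True
  have "(l - 1)\<^sup>2 \<le> \<gamma> * (l - 1) + 2 * \<gamma>"
    using less_ell1_plus_iff[OF assms(1,2)] assms(3) by simp
  then have "(l - 1) * l \<le> (1 + \<gamma>) * (l - 1) + 2 * \<gamma>"
    by (simp add: power2_eq_square algebra_simps)
  then have "(l - 1) * l / (l * (l - 1 + \<gamma>)) \<le> ((1 + \<gamma>) * (l - 1) + 2 * \<gamma>) / (l * (l - 1 + \<gamma>))"
    using assms by (intro divide_right_mono) auto
  then show ?thesis
    unfolding trace_coeffs_above[OF assms(1) True] using assms(2) by simp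
next
  case False
  then show ?thesis
    using assms by (simp add: trace_offset_def trace_slope_def cosine_def sine_def)
qed

text \<open>Only block \<open>k\<close> and the singular value 1 are compared. The ratio within the
  block suffices, except for a spike up to the threshold with \<eta> below 1: there that ratio may
  drop below \<open>w / u\<close>, and the singular value 1 takes over.\<close>

lemma condition_number_asymptotic_pivot_ge:
  assumes "\<gamma> > 0" "p > 2 * r" "\<forall>i\<in>{1..r}. l i > 1" "\<forall>i\<in>{1..r}. \<eta> i > 0"
    and k: "k \<in> {1..r}"
  defines "\<eta>' \<equiv> if l k > ell1_plus \<gamma> then eta_opt (l k) \<gamma> else 1"
  assumes uw: "0 < u" "u \<le> w" "u + w = trace_offset (l k) \<gamma> + trace_slope (l k) \<gamma> * \<eta>'"
    "u * w = \<eta>' / l k"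
  shows "w / u \<le> condition_number (asymptotic_pivot p r \<gamma> l \<eta>)"
proof -
  define L e where "L = l k" and "e = \<eta> k"
  have L: "L > 1" "e > 0"
    using assms(3,4) k by (auto simp: L_def e_def)
  obtain v z where vz: "0 < v" "v \<le> z" "v + z = trace_offset L \<gamma> + trace_slope L \<gamma> * e" "v * z = e / L"
    "singular_values (pivot_block L e \<gamma>) = {v, z}"
    by (rule singular_values_pivot_block[OF assms(1) L])
  have mem: "1 \<in> singular_values (asymptotic_pivot p r \<gamma> l \<eta>)"
    "v \<in> singular_values (asymptotic_pivot p r \<gamma> l \<eta>)" "z \<in> singular_values (asymptotic_pivot p r \<gamma> l \<eta>)"
    using vz(5) k unfolding singular_values_asymptotic_pivot[OF assms(2)] L_def e_def by auto
  note ge = condition_number_ge[OF singular_values_asymptotic_pivot_finite_pos[OF assms(1-4)]]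
  define a b where "a = trace_offset L \<gamma>" and "b = trace_slope L \<gamma>"
  have ab: "a > 0" "b > 0" "a + b = 1 + 1 / L" "b \<le> 1"
    using trace_coeffs_pos[OF assms(1) L(1)] trace_offset_plus_slope[OF assms(1) L(1)]
      trace_slope_le_one[OF assms(1) L(1)] by (simp_all add: a_def b_def)
  have sum: "u + w = a + b * \<eta>'" "v + z = a + b * e"
    using uw(3) vz(3) by (simp_all add: a_def b_def L_def)
  have prod: "u * w = \<eta>' / L"
    using uw(4) by (simp add: L_def)
  show ?thesis
  proof (cases "L \<le> ell1_plus \<gamma> \<and> e < 1")
    case True
    then have \<eta>': "\<eta>' = 1"
      by (simp add: \<eta>'_def L_def)
    have "(1 - u) * (1 - w) = 0"
      using sum(1) prod ab(3) by (simp add: \<eta>' algebra_simps)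
    then have "u = 1 \<or> w = 1"
      by simp
    then have "w / u = L"
      using sum(1) ab(3) uw(2) L(1) by (auto simp: \<eta>')
    \<comment> \<open>\<open>1 / L\<close> separates the roots, and so the singular values 1 and \<open>v\<close> have ratio at least \<open>L\<close>.\<close>
    have "(1 / L - v) * (1 / L - z) = (1 / L)\<^sup>2 - (v + z) / L + v * z"
      by (simp add: power2_eq_square algebra_simps add_divide_distrib)
    also have "\<dots> = (1 / L)\<^sup>2 - (1 + 1 / L - b + b * e) / L + e / L"
      using sum(2) vz(4) ab(3) by (simp add: algebra_simps)
    also have "\<dots> = - ((1 - e) * (1 - b) / L)"
      using L by (simp add: field_simps power2_eq_square)
    also have "\<dots> \<le> 0"
      using True ab L by simp
    finally have "v \<le> 1 / L"
      using vz(2) by (auto simp: mult_le_0_iff)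
    then have "L \<le> 1 / v"
      using vz(1) L by (simp add: field_simps)
    then show ?thesis
      using ge[OF mem(2) mem(1)] \<open>w / u = L\<close> by simp
  next
    case False
    \<comment> \<open>Cross-multiplied comparison of squared trace over determinant for the two
      blocks.\<close>
    have "(a + b * \<eta>')\<^sup>2 * e \<le> (a + b * e)\<^sup>2 * \<eta>'"
    proof (cases "L > ell1_plus \<gamma>")
      case True
      then have "L > ell_plus \<gamma>"
        using ell_plus_less_ell1_plus[OF assms(1)] by simp
      note opt = eta_opt(1,2)[OF assms(1) this]
      have \<eta>': "\<eta>' > 0" "a = b * \<eta>'"
        using opt True by (simp_all add: \<eta>'_def L_def a_def b_def)
      \<comment> \<open>Substituting \<open>a = b * \<eta>'\<close> leaves a multiple of a perfect
        square, which is AM-GM.\<close>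
      have "(a + b * e)\<^sup>2 * \<eta>' - (a + b * \<eta>')\<^sup>2 * e = b\<^sup>2 * \<eta>' * (\<eta>' - e)\<^sup>2"
        unfolding \<eta>'(2) by (simp add: power2_eq_square algebra_simps)
      moreover have "b\<^sup>2 * \<eta>' * (\<eta>' - e)\<^sup>2 \<ge> 0"
        using \<eta>'(1) by simp
      ultimately show ?thesis
        by linarith
    next
      case le: False
      have \<eta>': "\<eta>' = 1"
        using le by (simp add: \<eta>'_def L_def)
      have "e \<ge> 1"
        using False le by simp
      have "a \<le> b"
        using trace_offset_le_slope[OF assms(1) L(1)] le by (simp add: a_def b_def)
      then have "a * a \<le> b * b * e"
        using ab \<open>e \<ge> 1\<close> mult_mono[of a b a b] mult_mono[of "a * a" "b * b" 1 e] by simp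
      \<comment> \<open>With \<open>\<eta>' = 1\<close> this product is exactly the difference of
        the two sides.\<close>
      then have "(e - 1) * (b * b * e - a * a) \<ge> 0"
        using \<open>e \<ge> 1\<close> by simp
      then show ?thesis
        by (simp add: \<eta>' power2_eq_square algebra_simps)
    qed
    then have "(u + w)\<^sup>2 * (v * z) \<le> (v + z)\<^sup>2 * (u * w)"
      unfolding sum prod vz(4) using L(1) by (simp add: divide_right_mono)
    then have "w / u \<le> z / v"
      using ratio_le_of_sum_square_le[OF vz(1,2) uw(1,2)] by simp
    also have "\<dots> \<le> condition_number (asymptotic_pivot p r \<gamma> l \<eta>)"
      using ge mem by simp
    finally show ?thesis .
  qed
qed

text \<open>All singular values lie in the interval of the largest spike: by nestedness if that
  spike is past the threshold; otherwise every block has \<eta> = 1 and contributes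
  \<open>1 / l i\<close> and 1.\<close>

lemma condition_number_asymptotic_pivot_le:
  assumes \<gamma>: "\<gamma> > 0" "\<gamma>\<^sup>2 + \<gamma> > 1" and p: "p > 2 * r" and l: "\<forall>i\<in>{1..r}. l i > 1"
    and k: "k \<in> {1..r}" "\<forall>i\<in>{1..r}. l i \<le> l k"
  defines "\<eta> \<equiv> \<lambda>i. if l i > ell1_plus \<gamma> then eta_opt (l i) \<gamma> else 1"
  assumes uw: "0 < u" "u \<le> w" "singular_values (pivot_block (l k) (\<eta> k) \<gamma>) = {u, w}"
    "u + w = trace_offset (l k) \<gamma> + trace_slope (l k) \<gamma> * \<eta> k" "u * w = \<eta> k / l k"
  shows "condition_number (asymptotic_pivot p r \<gamma> l \<eta>) \<le> w / u"
proof -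
  have lk: "l k > 1"
    using l k by simp
  have "1 \<in> {u..w} \<and> (\<forall>i\<in>{1..r}. singular_values (pivot_block (l i) (\<eta> i) \<gamma>) \<subseteq> {u..w})"
  proof (cases "l k > ell1_plus \<gamma>")
    case True
    have \<eta>k: "\<eta> k = eta_opt (l k) \<gamma>"
      using True by (simp add: \<eta>_def)
    have "u < 1 \<and> 1 < w \<and> singular_values (pivot_block (l i) (\<eta> i) \<gamma>) \<subseteq> {u..w}"
      if "i \<in> {1..r}" for i
      using singular_values_pivot_block_nested[OF \<gamma> _ _ True uw[unfolded \<eta>k], of "l i"] l k(2) that
      unfolding \<eta>_def by auto
    then show ?thesis
      using k(1) by (auto simp: less_imp_le)
  next
    case False
    then have "{u, w} = {1 / l k, 1}"
      using uw(3) singular_values_pivot_block_one[OF \<gamma>(1) lk] by (simp add: \<eta>_def)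
    moreover have "1 / l k < 1"
      using lk by simp
    ultimately have *: "u = 1 / l k" "w = 1"
      using uw(2) by (auto simp: doubleton_eq_iff)
    have "singular_values (pivot_block (l i) (\<eta> i) \<gamma>) \<subseteq> {u..w}" if "i \<in> {1..r}" for i
    proof -
      have "l i > 1" "l i \<le> l k"
        using l k that by auto
      then show ?thesis
        using False singular_values_pivot_block_one[OF \<gamma>(1), of "l i"]
        by (auto simp: \<eta>_def * frac_le)
    qed
    then show ?thesis
      using * lk by auto
  qed
  then have sub: "singular_values (asymptotic_pivot p r \<gamma> l \<eta>) \<subseteq> {u..w}"
    unfolding singular_values_asymptotic_pivot[OF p] by auto
  have pos: "\<forall>i\<in>{1..r}. \<eta> i > 0"
    using eta_opt(1)[OF \<gamma>(1)] ell_plus_less_ell1_plus[OF \<gamma>(1)] by (auto simp: \<eta>_def)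
  show ?thesis
    by (rule condition_number_le[OF singular_values_asymptotic_pivot_finite_pos(1)[OF \<gamma>(1) p l pos] _ sub uw(1)])
      (simp add: singular_values_asymptotic_pivot[OF p])
qed

theorem theorem4p1p1:
  shows "{\<gamma>::real. \<gamma> > 0 \<and> \<gamma> - sqrt \<gamma> * sqrt (1 + \<gamma>) = - \<gamma> / (1 + \<gamma>)} = {(sqrt 5 - 1) / 2} \<and>
    (\<forall>\<gamma>::real. \<gamma> > (sqrt 5 - 1) / 2 \<longrightarrow>
      (\<forall>(r::nat) (p::nat) (l :: nat \<Rightarrow> real).
        r > 1 \<longrightarrow> p > 2 * r \<longrightarrow>
        strict_antimono_on {1..r} l \<longrightarrow> (\<forall>i\<in>{1..r}. l i > 1) \<longrightarrow>
        is_arg_min (\<lambda>\<eta> :: nat \<Rightarrow> real. condition_number (asymptotic_pivot p r \<gamma> l \<eta>))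
          (\<lambda>\<eta>. \<forall>i\<in>{1..r}. \<eta> i > 0)
          (\<lambda>i. eta1_star (lambda_of (l i) \<gamma>) \<gamma>)))"
proof (rule conjI[OF golden_equation], intro allI impI)
  fix \<gamma> :: real and r p :: nat and l :: "nat \<Rightarrow> real"
  assume \<gamma>: "\<gamma> > (sqrt 5 - 1) / 2" and r: "r > 1" and p: "p > 2 * r"
    and anti: "strict_antimono_on {1..r} l" and l: "\<forall>i\<in>{1..r}. l i > 1"
  note \<gamma>' = above_golden_ratio[OF \<gamma>]
  define \<eta>s where "\<eta>s = (\<lambda>i. eta1_star (lambda_of (l i) \<gamma>) \<gamma>)"
  define \<eta>o where "\<eta>o = (\<lambda>i. if l i > ell1_plus \<gamma> then eta_opt (l i) \<gamma> else 1)"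
  \<comment> \<open>Agreement on \<open>{1..r}\<close>, where \<open>l i > 1\<close> is known, is
    enough: the pivot reads no other index.\<close>
  have eq: "\<eta>s i = \<eta>o i" if "i \<in> {1..r}" for i
    using eta1_star_lambda_of[OF \<gamma>'(1)] l that by (simp add: \<eta>s_def \<eta>o_def)
  have same: "asymptotic_pivot p r \<gamma> l \<eta>s = asymptotic_pivot p r \<gamma> l \<eta>o"
    unfolding asymptotic_pivot_def
    by (intro arg_cong[where f = diag_block_mat] arg_cong2[where f = append] map_cong refl)
      (auto simp: eq)
  have pos: "\<eta>o i > 0" for i
    using eta_opt(1)[OF \<gamma>'(1)] ell_plus_less_ell1_plus[OF \<gamma>'(1)] by (auto simp: \<eta>o_def)
  have k: "1 \<in> {1..r}" "\<forall>i\<in>{1..r}. l i \<le> l 1"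
  proof -
    show "1 \<in> {1..r}"
      using r by simp
    then show "\<forall>i\<in>{1..r}. l i \<le> l 1"
      using anti by (metis atLeastAtMost_iff le_neq_implies_less less_imp_le monotone_onD order_refl)
  qed
  have "l 1 > 1"
    using l k(1) by blast
  obtain u w where uw: "0 < u" "u \<le> w" "u + w = trace_offset (l 1) \<gamma> + trace_slope (l 1) \<gamma> * \<eta>o 1"
    "u * w = \<eta>o 1 / l 1" "singular_values (pivot_block (l 1) (\<eta>o 1) \<gamma>) = {u, w}"
    by (rule singular_values_pivot_block[OF \<gamma>'(1) \<open>l 1 > 1\<close> pos])
  have "condition_number (asymptotic_pivot p r \<gamma> l \<eta>o) \<le> w / u"
    using condition_number_asymptotic_pivot_le[OF \<gamma>' p l k _ _ _ uw(3,4)[unfolded \<eta>o_def]]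
      uw(1,2,5) unfolding \<eta>o_def by simp
  then have upper: "condition_number (asymptotic_pivot p r \<gamma> l \<eta>s) \<le> w / u"
    using same by simp
  have lower: "w / u \<le> condition_number (asymptotic_pivot p r \<gamma> l \<eta>)" if "\<forall>i\<in>{1..r}. \<eta> i > 0" for \<eta>
    using condition_number_asymptotic_pivot_ge[where k = 1, OF \<gamma>'(1) p l that k(1) _ _ uw(3,4)[unfolded \<eta>o_def]]
      uw(1,2) by simp
  have "is_arg_min (\<lambda>\<eta>. condition_number (asymptotic_pivot p r \<gamma> l \<eta>)) (\<lambda>\<eta>. \<forall>i\<in>{1..r}. \<eta> i > 0) \<eta>s"
    unfolding is_arg_min_def not_ex de_Morgan_conj not_less
  proof (intro conjI allI)
    show "\<forall>i\<in>{1..r}. \<eta>s i > 0"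
      using eq pos by simp
    show "\<not> (\<forall>i\<in>{1..r}. \<eta> i > 0) \<or> condition_number (asymptotic_pivot p r \<gamma> l \<eta>s)
        \<le> condition_number (asymptotic_pivot p r \<gamma> l \<eta>)" for \<eta>
      using order_trans[OF upper lower] by blast
  qed
  then show "is_arg_min (\<lambda>\<eta>. condition_number (asymptotic_pivot p r \<gamma> l \<eta>)) (\<lambda>\<eta>. \<forall>i\<in>{1..r}. \<eta> i > 0)
      (\<lambda>i. eta1_star (lambda_of (l i) \<gamma>) \<gamma>)"
    unfolding \<eta>s_def .
qed

end
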